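(* Let $(S,\cdot,\le)$ be an ordered groupoid and $f$ a fuzzy subset of $S$ such that (a) for all $a,x,y\in S$, if $a\le xy$ then $\min\{f(x^2),f(y^2)\}\le f(a)$; and (b) if $g$ is a fuzzy subset of $S$ such that $g\circ g\preceq f$, then $g\preceq f$. Then $f$ is fuzzy semiprime, that is, $f(x)\ge f(x^2)$ for every $x\in S$.
   Context: An ordered groupoid $(S,\cdot,\le)$ is a (partially) ordered set $(S,\le)$ endowed with a binary multiplication (not assumed associative) compatible with the order: $a\le b$ implies $ac\le bc$ and $ca\le cb$ for every $c\in S$. Write $x^2=x\cdot x$. A fuzzy subset of $S$ is a mapping $f:S\to[0,1]$ into the closed real unit interval. For $a\in S$ let $A_a=\{(x,y)\in S\times S \mid a\le xy\}$. For fuzzy subsets $f,g$ of $S$, the product $f\circ g$ is the fuzzy subset of $S$ given by $(f\circ g)(a)=\sup_{(x,y)\in A_a}\min\{f(x),g(y)\}$ if $A_a\neq\emptyset$, and $(f\circ g)(a)=0$ if $A_a=\emptyset$. The order on fuzzy subsets is: $f\preceq g$ if and only if $f(x)\le g(x)$ for all $x\in S$. *)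

theory Defs
  imports Complex_Main
begin

class ordered_groupoid = order + times +
  assumes mult_right_mono_groupoid: "a \<le> b \<Longrightarrow> a * c \<le> b * c"
    and mult_left_mono_groupoid: "a \<le> b \<Longrightarrow> c * a \<le> c * b"

(* The order on fuzzy subsets is the pointwise order \<le> on functions. *)
definition fuzzy_subset :: "('a \<Rightarrow> real) \<Rightarrow> bool" where
  "fuzzy_subset f \<longleftrightarrow> (\<forall>x. f x \<in> {0..1})"

definition factor_pairs :: "'a::ordered_groupoid \<Rightarrow> ('a \<times> 'a) set" where
  "factor_pairs a = {(x, y). a \<le> x * y}"

(* The empty case is separate because Sup {} is unspecified on the reals. *)
definition fuzzy_prod ::
  "('a::ordered_groupoid \<Rightarrow> real) \<Rightarrow> ('a \<Rightarrow> real) \<Rightarrow> 'a \<Rightarrow> real" where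
  "fuzzy_prod f g a =
     (if factor_pairs a = {} then 0
      else (SUP (x, y)\<in>factor_pairs a. min (f x) (g y)))"

definition fuzzy_semiprime :: "('a::ordered_groupoid \<Rightarrow> real) \<Rightarrow> bool" where
  "fuzzy_semiprime f \<longleftrightarrow> (\<forall>x. f x \<ge> f (x * x))"

end

theory Submission
  imports Defs
begin

text \<open>
  The map \<open>g x = f (x * x)\<close> is itself a fuzzy subset, and fuzzy semiprimeness of \<open>f\<close> is exactly
  the inequality \<open>g \<le> f\<close>. Condition (a) says that every member of the family whose supremum is
  \<open>(g \<circ> g) a\<close> is at most \<open>f a\<close>, so \<open>g \<circ> g \<preceq> f\<close>, and condition (b) applied to this \<open>g\<close> gives the
  claim.
\<close>

text \<open>
  This replaces the supremum by a pointwise condition on factorizations. Nonnegativity of \<open>h\<close>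
  covers the elements that lie below no product, where the fuzzy product is \<open>0\<close> by convention.
\<close>

lemma fuzzy_prod_leI:
  fixes f g h :: "'a::ordered_groupoid \<Rightarrow> real"
  assumes "\<And>a. 0 \<le> h a"
    and "\<And>a x y. a \<le> x * y \<Longrightarrow> min (f x) (g y) \<le> h a"
  shows "fuzzy_prod f g \<le> h"
proof (rule le_funI)
  fix a
  show "fuzzy_prod f g a \<le> h a"
  proof (cases "factor_pairs a = {}")
    case True
    then show ?thesis
      using assms(1) by (simp add: fuzzy_prod_def)
  next
    case False
    then have "(SUP (x, y)\<in>factor_pairs a. min (f x) (g y)) \<le> h a"
      by (rule cSUP_least) (use assms(2) in \<open>auto simp: factor_pairs_def\<close>)
    with False show ?thesis
      by (simp add: fuzzy_prod_def)
  qed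
qed

theorem theorem5:
  fixes f :: "'a::ordered_groupoid \<Rightarrow> real"
  assumes "fuzzy_subset f"
    and "\<And>a x y. a \<le> x * y \<Longrightarrow> min (f (x * x)) (f (y * y)) \<le> f a"
    and "\<And>g. fuzzy_subset g \<Longrightarrow> fuzzy_prod g g \<le> f \<Longrightarrow> g \<le> f"
  shows "fuzzy_semiprime f"
proof -
  let ?g = "\<lambda>x. f (x * x)"
  have "fuzzy_subset ?g"
    using assms(1) by (simp add: fuzzy_subset_def)
  moreover have "fuzzy_prod ?g ?g \<le> f"
  proof (rule fuzzy_prod_leI)
    show "0 \<le> f a" for a
      using assms(1) by (simp add: fuzzy_subset_def)
  qed (rule assms(2))
  ultimately have "?g \<le> f"
    by (rule assms(3))
  then show ?thesis
    by (simp add: fuzzy_semiprime_def le_fun_def)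
qed

end
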